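(* Let $k\ge 0$ be an integer and let $G$ be a graph of order $n\ge 5k+7$, where $n\equiv k \pmod 2$. If $q(G)\ge q(K_2\vee ((k+1)K_1\cup K_{n-k-3}))$, then for every edge $e$ of $G$, $G$ has a matching of size $\frac{n-k}{2}$ containing $e$, unless $G\cong K_2\vee ((k+1)K_1\cup K_{n-k-3})$.
   Context: All graphs are finite, simple and undirected. $q(G)$ denotes the signless Laplacian spectral radius of $G$, i.e. the largest eigenvalue of $\mathbf{D}(G)+\mathbf{A}(G)$, where $\mathbf{D}(G)$ is the diagonal degree matrix and $\mathbf{A}(G)$ the adjacency matrix. $K_m$ is the complete graph on $m$ vertices, $mH$ is the disjoint union of $m$ copies of $H$, $\cup$ is disjoint union, and $G_1\vee G_2$ is the join (disjoint union plus all edges between $V(G_1)$ and $V(G_2)$). *)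

theory Defs
  imports "Graph_Theory.Graph_Theory" "Jordan_Normal_Form.Spectral_Radius"
begin

text \<open>
  Finite simple undirected graphs are rendered by the locale \<^locale>\<open>pair_graph\<close>: a finite vertex
  set with a symmetric, irreflexive set of arcs, so that an undirected edge is a pair of opposite
  arcs. The set of edges proper consists of the two-element vertex sets underlying the arcs.
\<close>

definition uedges :: "'a pair_pre_digraph \<Rightarrow> 'a set set" where
  "uedges G = {{u, v} | u v. (u, v) \<in> parcs G}"

definition matching :: "'a pair_pre_digraph \<Rightarrow> 'a set set \<Rightarrow> bool" where
  "matching G M \<longleftrightarrow> M \<subseteq> uedges G \<and> (\<forall>e\<in>M. \<forall>f\<in>M. e \<noteq> f \<longrightarrow> e \<inter> f = {})"

definition graph_iso :: "'a pair_pre_digraph \<Rightarrow> 'b pair_pre_digraph \<Rightarrow> bool" where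
  "graph_iso G H \<longleftrightarrow> digraph_iso (with_proj G) (with_proj H)"

definition complete_graph :: "nat \<Rightarrow> nat pair_pre_digraph" where
  "complete_graph m = \<lparr>pverts = {..<m}, parcs = {(u, v). u < m \<and> v < m \<and> u \<noteq> v}\<rparr>"

definition disj_union ::
    "'a pair_pre_digraph \<Rightarrow> 'b pair_pre_digraph \<Rightarrow> ('a + 'b) pair_pre_digraph" where
  "disj_union G H = \<lparr>pverts = pverts G <+> pverts H,
     parcs = map_prod Inl Inl ` parcs G \<union> map_prod Inr Inr ` parcs H\<rparr>"

definition copies :: "nat \<Rightarrow> 'a pair_pre_digraph \<Rightarrow> (nat \<times> 'a) pair_pre_digraph" where
  "copies m H = \<lparr>pverts = {..<m} \<times> pverts H,
     parcs = {((i, u), (i, v)) | i u v. i < m \<and> (u, v) \<in> parcs H}\<rparr>"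

definition graph_join ::
    "'a pair_pre_digraph \<Rightarrow> 'b pair_pre_digraph \<Rightarrow> ('a + 'b) pair_pre_digraph" where
  "graph_join G H = \<lparr>pverts = pverts (disj_union G H),
     parcs = parcs (disj_union G H)
       \<union> (Inl ` pverts G) \<times> (Inr ` pverts H) \<union> (Inr ` pverts H) \<times> (Inl ` pverts G)\<rparr>"

text \<open>
  The matrices of a graph depend on an enumeration of its vertices, given here as a list.
  Since arcs come in opposite pairs, the out-degree is the degree.
\<close>

definition degree_mat :: "'a pair_pre_digraph \<Rightarrow> 'a list \<Rightarrow> real mat" where
  "degree_mat G vs = mat (length vs) (length vs)
     (\<lambda>(i, j). if i = j then real (out_degree (with_proj G) (vs ! i)) else 0)"

definition adjacency_mat :: "'a pair_pre_digraph \<Rightarrow> 'a list \<Rightarrow> real mat" where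
  "adjacency_mat G vs = mat (length vs) (length vs)
     (\<lambda>(i, j). if (vs ! i, vs ! j) \<in> parcs G then 1 else 0)"

definition signless_laplacian :: "'a pair_pre_digraph \<Rightarrow> 'a list \<Rightarrow> real mat" where
  "signless_laplacian G vs = degree_mat G vs + adjacency_mat G vs"

text \<open>
  The largest real eigenvalue. All eigenvalues are real because the matrix is symmetric, and
  their set does not depend on the enumeration (see \<open>spectrum_signless_laplacian\<close> below).
  The value is meaningful only for a nonempty vertex set.
\<close>

definition signless_spectral_radius :: "'a pair_pre_digraph \<Rightarrow> real" where
  "signless_spectral_radius G =
     Max (spectrum (signless_laplacian G (SOME vs. distinct vs \<and> set vs = pverts G)))"

lemma spectrum_signless_laplacian:
  assumes G: "pair_graph G" and vs: "distinct vs" "set vs = pverts G"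
  shows "spectrum (signless_laplacian G vs) =
    {l. \<exists>x. (\<exists>v\<in>pverts G. x v \<noteq> 0) \<and>
       (\<forall>v\<in>pverts G. real (out_degree (with_proj G) v) * x v + (\<Sum>u | (v, u) \<in> parcs G. x u) = l * x v)}"
    (is "_ = {l. ?P l}")
proof -
  interpret pair_graph G by (rule G)
  let ?n = "length vs" and ?d = "\<lambda>v. real (out_degree (with_proj G) v)"
  let ?Q = "signless_laplacian G vs"
  have Q: "?Q \<in> carrier_mat ?n ?n"
    by (simp add: signless_laplacian_def degree_mat_def adjacency_mat_def)
  have Qx: "(?Q *\<^sub>v vec ?n (\<lambda>i. x (vs ! i))) $ i
      = ?d (vs ! i) * x (vs ! i) + (\<Sum>u | (vs ! i, u) \<in> parcs G. x u)"
    if i: "i < ?n" for x i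
  proof -
    have "(?Q *\<^sub>v vec ?n (\<lambda>i. x (vs ! i))) $ i
        = (\<Sum>j<?n. ((if i = j then ?d (vs ! i) else 0)
            + (if (vs ! i, vs ! j) \<in> parcs G then 1 else 0)) * x (vs ! j))"
      using i Q
      by (auto simp: scalar_prod_def signless_laplacian_def degree_mat_def adjacency_mat_def
          lessThan_atLeast0 intro!: sum.cong)
    also have "\<dots> = (\<Sum>j<?n. if i = j then ?d (vs ! i) * x (vs ! i) else 0)
        + (\<Sum>j<?n. if (vs ! i, vs ! j) \<in> parcs G then x (vs ! j) else 0)"
      unfolding sum.distrib[symmetric] by (intro sum.cong) (auto simp: algebra_simps)
    also have "(\<Sum>j<?n. if i = j then ?d (vs ! i) * x (vs ! i) else 0) = ?d (vs ! i) * x (vs ! i)"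
      using i by simp
    also have "(\<Sum>j<?n. if (vs ! i, vs ! j) \<in> parcs G then x (vs ! j) else 0)
        = (\<Sum>u\<in>pverts G. if (vs ! i, u) \<in> parcs G then x u else 0)"
      by (rule sum.reindex_bij_betw[OF bij_betw_nth]) (use vs in auto)
    also have "\<dots> = (\<Sum>u | (vs ! i, u) \<in> parcs G. x u)"
      by (subst sum.inter_filter[symmetric])
         (auto intro!: sum.cong dest: in_arcsD2 simp: pair_finite_verts)
    finally show ?thesis .
  qed
  have "eigenvalue ?Q l \<longleftrightarrow> ?P l" for l
  proof
    assume "eigenvalue ?Q l"
    then obtain w where w: "w \<in> carrier_vec ?n" "w \<noteq> 0\<^sub>v ?n" "?Q *\<^sub>v w = l \<cdot>\<^sub>v w"
      using Q unfolding eigenvalue_def eigenvector_def by auto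
    define x where "x = (\<lambda>v. w $ (THE i. i < ?n \<and> vs ! i = v))"
    have xi: "x (vs ! i) = w $ i" if "i < ?n" for i
    proof -
      have "(THE j. j < ?n \<and> vs ! j = vs ! i) = i"
        using that vs(1) by (intro the_equality) (auto simp: nth_eq_iff_index_eq)
      then show ?thesis by (simp add: x_def)
    qed
    have wx: "w = vec ?n (\<lambda>i. x (vs ! i))"
      using w(1) xi by (intro eq_vecI) auto
    obtain i where i: "i < ?n" "w $ i \<noteq> 0"
      using w(1,2) by (metis carrier_vecD eq_vecI index_zero_vec)
    have "?d v * x v + (\<Sum>u | (v, u) \<in> parcs G. x u) = l * x v" if "v \<in> pverts G" for v
    proof -
      have "v \<in> set vs" using that vs(2) by simp
      then obtain i where i: "i < ?n" "v = vs ! i" unfolding in_set_conv_nth by blast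
      have "(?Q *\<^sub>v w) $ i = l * w $ i" using w i by simp
      then show ?thesis using Qx[OF i(1), of x] i xi by (simp add: wx[symmetric])
    qed
    moreover have "vs ! i \<in> pverts G" "x (vs ! i) \<noteq> 0" using i xi vs(2) by auto
    ultimately show "?P l" by blast
  next
    assume "?P l"
    then obtain x v where x: "v \<in> pverts G" "x v \<noteq> 0"
      "\<And>v. v \<in> pverts G \<Longrightarrow> ?d v * x v + (\<Sum>u | (v, u) \<in> parcs G. x u) = l * x v" by blast
    let ?w = "vec ?n (\<lambda>i. x (vs ! i))"
    have "v \<in> set vs" using x(1) vs(2) by simp
    then obtain i where i: "i < ?n" "v = vs ! i" unfolding in_set_conv_nth by blast
    have "?w $ i \<noteq> 0\<^sub>v ?n $ i" using i x(2) by simp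
    then have "?w \<noteq> 0\<^sub>v ?n" by (rule contrapos_nn) (rule arg_cong)
    moreover have "?Q *\<^sub>v ?w = l \<cdot>\<^sub>v ?w"
    proof (rule eq_vecI)
      fix j assume "j < dim_vec (l \<cdot>\<^sub>v ?w)"
      then have j: "j < ?n" by simp
      then have "vs ! j \<in> pverts G" using vs(2) nth_mem by blast
      then show "(?Q *\<^sub>v ?w) $ j = (l \<cdot>\<^sub>v ?w) $ j" using Qx[OF j, of x] x(3) j by simp
    qed (use Q in auto)
    ultimately have "eigenvector ?Q ?w l" using Q by (auto simp: eigenvector_def)
    then show "eigenvalue ?Q l" by (auto simp: eigenvalue_def)
  qed
  then show ?thesis by (auto simp: spectrum_def)
qed

end

theory Submission
  imports Defs "HOL-Library.Disjoint_Sets"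
begin

text \<open>
  If no matching of size \<open>(n - k) / 2\<close> contains the edge \<open>e\<close>, the Tutte--Berge formula for \<open>G\<close> minus
  the ends of \<open>e\<close>, with these ends added to the barrier, yields a set \<open>S\<close> with \<open>s = |S| \<ge> 2\<close> such that
  \<open>G - S\<close> has at least \<open>s + k\<close> components. By Collatz--Wielandt, a positive vector \<open>x\<close> with \<open>Q x \<le> \<lambda> x\<close>
  bounds every signless Laplacian eigenvalue by \<open>\<lambda>\<close>. If \<open>s \<ge> 3\<close>, or \<open>s = 2\<close> and the largest component
  has fewer than \<open>n - k - 3\<close> vertices, such a vector exists for \<open>\<lambda> = 2(n - k - 2)\<close>, and \<open>\<lambda> < q(H)\<close> since
  \<open>H\<close> properly contains \<open>K\<^bsub>n - k - 1\<^esub>\<close>. In the remaining case \<open>G\<close> is a spanning subgraph of \<open>H\<close>, and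
  comparison with the Perron vector of \<open>H\<close> gives \<open>q(G) < q(H)\<close> unless \<open>G = H\<close>. The parity condition
  excludes \<open>n = 5k + 7\<close>.
\<close>

section \<open>Maximum matchings\<close>

text \<open>Phrased for a bare edge set, so that deleting vertices amounts to filtering the
  edges.\<close>

definition is_matching :: "'a set set \<Rightarrow> 'a set set \<Rightarrow> bool" where
  "is_matching E M \<longleftrightarrow> M \<subseteq> E \<and> disjoint M"

definition maximum_matching :: "'a set set \<Rightarrow> 'a set set \<Rightarrow> bool" where
  "maximum_matching E M \<longleftrightarrow> is_matching E M \<and> (\<forall>N. is_matching E N \<longrightarrow> card N \<le> card M)"

lemma card_Union_matching:
  assumes "is_matching E M" "\<And>e. e \<in> E \<Longrightarrow> card e = 2"
  shows "card (\<Union>M) = 2 * card M"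
proof -
  have *: "card e = 2" if "e \<in> M" for e using assms that by (auto simp: is_matching_def)
  then have "card (\<Union>M) = sum card M"
    using assms(1) by (intro card_Union_disjoint)
      (auto simp: is_matching_def disjoint_def pairwise_def disjnt_def intro: card_ge_0_finite)
  with * show ?thesis by simp
qed

lemma maximum_matching_exists:
  assumes "finite E"
  obtains M where "maximum_matching E M"
proof -
  have "is_matching E {}" by (simp add: is_matching_def disjoint_def)
  moreover have "\<forall>M. is_matching E M \<longrightarrow> card M < Suc (card E)"
    using assms by (auto simp: is_matching_def less_Suc_eq_le intro: card_mono)
  ultimately show thesis
    using ex_has_greatest_nat[of "is_matching E" "{}" card "Suc (card E)"] that
    unfolding maximum_matching_def by (metis order.strict_implies_order)
qed

lemma maximum_matching_card_eq:
  "maximum_matching E M \<Longrightarrow> maximum_matching E N \<Longrightarrow> card M = card N"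
  by (simp add: maximum_matching_def le_antisym)

lemma is_matching_insert:
  assumes "is_matching E M" "e \<in> E" "e \<inter> \<Union>M = {}"
  shows "is_matching E (insert e M)"
  using assms by (auto simp: is_matching_def disjoint_def)

text \<open>Otherwise the edge could be added. So no maximum matching misses both ends of an
  edge.\<close>

lemma maximum_matching_covers_edge:
  assumes E: "finite E" "\<And>e. e \<in> E \<Longrightarrow> card e = 2"
    and M: "maximum_matching E M" and e: "e \<in> E"
  shows "e \<inter> \<Union>M \<noteq> {}"
proof
  assume disj: "e \<inter> \<Union>M = {}"
  have "e \<noteq> {}" using E(2)[OF e] by auto
  with disj have "e \<notin> M" by auto
  moreover have "finite M"
    using M E(1) by (auto simp: maximum_matching_def is_matching_def intro: finite_subset)
  moreover have "is_matching E (insert e M)"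
    using M e disj by (intro is_matching_insert) (auto simp: maximum_matching_def)
  ultimately show False using M by (force simp: maximum_matching_def)
qed

text \<open>Gallai's lemma. Among the maximum matchings that miss \<open>v\<close>, one sharing as many edges as
  possible with \<open>M\<close> could be brought closer to \<open>M\<close> by exchanging a single edge.\<close>

lemma gallai_transitive:
  assumes E: "finite E" "\<And>e. e \<in> E \<Longrightarrow> card e = 2"
    and v: "maximum_matching E N0" "v \<notin> \<Union>N0"
    and uv: "\<And>K. maximum_matching E K \<Longrightarrow> u \<in> \<Union>K \<or> v \<in> \<Union>K"
    and vw: "\<And>K. maximum_matching E K \<Longrightarrow> v \<in> \<Union>K \<or> w \<in> \<Union>K"
    and "u \<noteq> w" and M: "maximum_matching E M"
  shows "u \<in> \<Union>M \<or> w \<in> \<Union>M"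
proof (rule ccontr)
  assume "\<not> ?thesis"
  then have uM: "u \<notin> \<Union>M" and wM: "w \<notin> \<Union>M" by auto
  have fin: "finite K" "finite (\<Union>K)" if "maximum_matching E K" for K
  proof -
    show "finite K" using that E(1)
      by (auto simp: maximum_matching_def is_matching_def intro: finite_subset)
    moreover have "finite e" if "e \<in> K" for e
      using E(2)[of e] that \<open>maximum_matching E K\<close>
      by (intro card_ge_0_finite) (auto simp: maximum_matching_def is_matching_def)
    ultimately show "finite (\<Union>K)" by blast
  qed
  define P where "P K \<longleftrightarrow> maximum_matching E K \<and> v \<notin> \<Union>K" for K
  have "P N0" using v by (simp add: P_def)
  moreover have "\<forall>K. P K \<longrightarrow> card (M \<inter> K) < Suc (card M)"
    using fin(1)[OF M] by (auto simp: less_Suc_eq_le intro: card_mono)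
  ultimately obtain N where "P N" and best: "\<And>K. P K \<Longrightarrow> card (M \<inter> K) \<le> card (M \<inter> N)"
    using ex_has_greatest_nat[of P N0 "\<lambda>K. card (M \<inter> K)" "Suc (card M)"]
    by (metis order.strict_implies_order)
  then have N: "maximum_matching E N" and vN: "v \<notin> \<Union>N" by (auto simp: P_def)
  have NE: "N \<subseteq> E" "disjoint N" and ME: "M \<subseteq> E" "disjoint M"
    using N M by (auto simp: maximum_matching_def is_matching_def)
  \<comment> \<open>Both matchings cover equally many vertices, and \<open>N\<close> alone covers
    \<open>u\<close> and \<open>w\<close>. So \<open>M\<close> alone covers at least two vertices,
    one of which is not \<open>v\<close>.\<close>
  have "card (\<Union>M) = card (\<Union>N)"
    using card_Union_matching[of E] E(2) M N maximum_matching_card_eq[OF M N]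
    by (simp add: maximum_matching_def)
  then have "card (\<Union>M - \<Union>N) = card (\<Union>N - \<Union>M)"
    using fin(2)[OF M] fin(2)[OF N] by (simp add: card_Diff_subset_Int Int_commute)
  moreover have "{u, w} \<subseteq> \<Union>N - \<Union>M" using uv[OF N] vw[OF N] vN uM wM by auto
  then have "card {u, w} \<le> card (\<Union>N - \<Union>M)" using fin(2)[OF N] by (intro card_mono) auto
  ultimately have "card (\<Union>M - \<Union>N) \<ge> 2" using \<open>u \<noteq> w\<close> by simp
  then have "\<not> \<Union>M - \<Union>N \<subseteq> {v}" using card_mono[of "{v}" "\<Union>M - \<Union>N"] by auto
  then obtain x f where x: "x \<in> f" "f \<in> M" "x \<notin> \<Union>N" "x \<noteq> v" by blast
  have fE: "f \<in> E" using x ME by auto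
  have "card (f - {x}) = 1" using E(2)[OF fE] x(1) by simp
  then obtain y where "f - {x} = {y}" by (rule card_1_singletonE)
  then have y: "f = {x, y}" "y \<noteq> x" using x(1) by blast+
  have "y \<in> \<Union>N" using maximum_matching_covers_edge[OF E N fE] x y by auto
  then obtain g where g: "y \<in> g" "g \<in> N" by auto
  have "x \<notin> g" using x(3) g(2) by blast
  then have "f \<noteq> g" "f \<inter> g \<noteq> {}" using x(1) y(1) g(1) by auto
  then have gM: "g \<notin> M" using ME(2) x(2) unfolding disjoint_def by meson
  \<comment> \<open>The exchange keeps \<open>v\<close> uncovered, since \<open>x\<close> differs
    from \<open>v\<close> and \<open>y\<close> is covered by \<open>N\<close>. It gains the edge
    \<open>f\<close> of \<open>M\<close> and loses only \<open>g\<close>, which is not in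
    \<open>M\<close>.\<close>
  define N' where "N' = insert f (N - {g})"
  have fN: "f \<notin> N" using x by auto
  have "y \<notin> h" if "h \<in> N - {g}" for h
    using NE(2) g that unfolding disjoint_def by (metis DiffE IntI empty_iff singletonI)
  then have "is_matching E N'" unfolding N'_def
    using N fE x y by (intro is_matching_insert) (auto simp: maximum_matching_def is_matching_def disjoint_def)
  moreover have "card N' = card N"
    using fin(1)[OF N] g(2) fN card_Suc_Diff1[of N g] unfolding N'_def by (subst card_insert_disjoint) auto
  ultimately have "maximum_matching E N'" using N by (simp add: maximum_matching_def)
  moreover have "v \<notin> \<Union>N'" using vN x y g by (auto simp: N'_def)
  ultimately have "card (M \<inter> N') \<le> card (M \<inter> N)" by (intro best) (simp add: P_def)
  moreover have "M \<inter> N' = insert f (M \<inter> N)" using gM x by (auto simp: N'_def)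
  then have "card (M \<inter> N') = Suc (card (M \<inter> N))" using fin(1)[OF M] fN by simp
  ultimately show False by simp
qed

text \<open>The nontrivial half of the Tutte--Berge formula. A labelling \<open>c\<close> that is constant along the edges
  avoiding \<open>S\<close> stands in for the components of \<open>G - S\<close>, and their parity is not recorded.\<close>

lemma tutte_berge:
  fixes V :: "'a set" and E :: "'a set set"
  assumes "finite V" "\<And>e. e \<in> E \<Longrightarrow> e \<subseteq> V \<and> card e = 2"
  shows "\<exists>M S (c :: 'a \<Rightarrow> 'a set). is_matching E M \<and> S \<subseteq> V
    \<and> (\<forall>u v. {u, v} \<in> E \<longrightarrow> u \<notin> S \<longrightarrow> v \<notin> S \<longrightarrow> c u = c v)
    \<and> card V + card S \<le> 2 * card M + card (c ` (V - S))"
  using assms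
proof (induction "card V" arbitrary: V E rule: less_induct)
  case less
  have E: "finite E" "\<And>e. e \<in> E \<Longrightarrow> card e = 2"
    using less.prems finite_subset[of E "Pow V"] by auto
  show ?case
  proof (cases "\<exists>v\<in>V. \<forall>K. maximum_matching E K \<longrightarrow> v \<in> \<Union>K")
    case True
    then obtain v where v: "v \<in> V" "\<And>K. maximum_matching E K \<Longrightarrow> v \<in> \<Union>K" by blast
    let ?E = "{e \<in> E. v \<notin> e}"
    have cV: "Suc (card (V - {v})) = card V" using less.prems(1) v(1) by (rule card_Suc_Diff1)
    then have "\<exists>M S (c :: 'a \<Rightarrow> 'a set). is_matching ?E M \<and> S \<subseteq> V - {v}
      \<and> (\<forall>a b. {a, b} \<in> ?E \<longrightarrow> a \<notin> S \<longrightarrow> b \<notin> S \<longrightarrow> c a = c b)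
      \<and> card (V - {v}) + card S \<le> 2 * card M + card (c ` (V - {v} - S))"
      using less.prems by (intro less.hyps) auto
    then obtain M S c where M: "is_matching ?E M" and S: "S \<subseteq> V - {v}"
      and c: "\<And>a b. {a, b} \<in> ?E \<Longrightarrow> a \<notin> S \<Longrightarrow> b \<notin> S \<Longrightarrow> c a = (c b :: 'a set)"
      and le: "card (V - {v}) + card S \<le> 2 * card M + card (c ` (V - {v} - S))" by blast
    \<comment> \<open>As \<open>M\<close> misses \<open>v\<close>, it is not maximum for
      \<open>E\<close>. The extra edge of a larger \<open>M'\<close> gains 2, which pays for
      \<open>v\<close> both in the vertex count and in the barrier.\<close>
    have ME: "is_matching E M" and "v \<notin> \<Union>M" using M by (auto simp: is_matching_def)
    then have "\<not> maximum_matching E M" using v(2) by blast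
    then obtain M' where M': "is_matching E M'" "card M < card M'"
      using ME by (auto simp: maximum_matching_def not_le)
    have "finite S" using S less.prems(1) by (meson finite_Diff finite_subset)
    then have "card (insert v S) = Suc (card S)" using S by (intro card_insert_disjoint) auto
    moreover have "V - insert v S = V - {v} - S" by auto
    ultimately have "card V + card (insert v S) \<le> 2 * card M' + card (c ` (V - insert v S))"
      using le cV M'(2) by simp
    then show ?thesis using M'(1) S v(1) c
      by (intro exI[of _ M'] exI[of _ "insert v S"] exI[of _ c]) auto
  next
    case False
    \<comment> \<open>Now every vertex is missed by some maximum matching, so Gallai's lemma makes
      "never both missed" an equivalence on \<open>V\<close>. Its classes serve as labels, with
      empty barrier.\<close>
    define R where "R u v \<longleftrightarrow> u = v \<or> (\<forall>K. maximum_matching E K \<longrightarrow> u \<in> \<Union>K \<or> v \<in> \<Union>K)" for u v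
    define c where "c u = {v \<in> V. R u v}" for u
    have sym: "R u v \<longleftrightarrow> R v u" for u v by (auto simp: R_def)
    have trans: "R u w" if uvw: "R u v" "R v w" "v \<in> V" for u v w
    proof -
      obtain N where "maximum_matching E N" "v \<notin> \<Union>N" using False uvw(3) by blast
      then show ?thesis
        using gallai_transitive[OF E, of N v u w] uvw(1,2) unfolding R_def by metis
    qed
    have edge: "c u = c v" if "{u, v} \<in> E" for u v
    proof -
      have "u \<in> V" "v \<in> V" using less.prems(2) that by auto
      moreover have "R u v"
        using maximum_matching_covers_edge[OF E _ that] by (auto simp: R_def)
      ultimately show ?thesis using trans sym by (auto simp: c_def)
    qed
    obtain M where M: "maximum_matching E M" using maximum_matching_exists[OF E(1)] .
    have finM: "finite (\<Union>M)"
      using M less.prems by (intro finite_subset[of "\<Union>M" V])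
        (auto simp: maximum_matching_def is_matching_def)
    \<comment> \<open>Related vertices are never both missed, so \<open>M\<close> misses at most one
      vertex of each class.\<close>
    have "inj_on c (V - \<Union>M)"
    proof (rule inj_onI)
      fix u w assume "u \<in> V - \<Union>M" "w \<in> V - \<Union>M" and "c u = c w"
      then have "R u w" by (auto simp: c_def R_def)
      then show "u = w" using M \<open>u \<in> _\<close> \<open>w \<in> _\<close> by (auto simp: R_def)
    qed
    then have "card (V - \<Union>M) = card (c ` (V - \<Union>M))" by (simp add: card_image)
    also have "\<dots> \<le> card (c ` V)" using less.prems(1) by (intro card_mono) auto
    finally have "card V - card (\<Union>M) \<le> card (c ` V)"
      using diff_card_le_card_Diff[of "\<Union>M" V] finM by simp
    moreover have "card (\<Union>M) = 2 * card M"
      using M E(2) by (intro card_Union_matching[of E]) (auto simp: maximum_matching_def)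
    ultimately have "card V + card {} \<le> 2 * card M + card (c ` (V - {}))" by simp
    then show ?thesis using M edge
      by (intro exI[of _ M] exI[of _ "{}"] exI[of _ c]) (auto simp: maximum_matching_def)
  qed
qed

section \<open>Signless Laplacian eigenvalues\<close>

text \<open>A complex eigenvalue exists; it is real because the Hermitian form \<open>q\<close>
  equals its own conjugate. The real or the imaginary part of the eigenvector is then a real
  eigenvector.\<close>

lemma symmetric_real_eigenvalue_exists:
  fixes A :: "real mat"
  assumes A: "A \<in> carrier_mat n n" and sym: "\<And>i j. i < n \<Longrightarrow> j < n \<Longrightarrow> A $$ (i, j) = A $$ (j, i)"
    and "n > 0"
  shows "spectrum A \<noteq> {}"
proof -
  let ?B = "map_mat complex_of_real A"
  have B: "?B \<in> carrier_mat n n" using A by simp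
  obtain l where "l \<in> spectrum ?B" using spectrum_non_empty[OF B] \<open>n > 0\<close> by auto
  then obtain w where w: "w \<in> carrier_vec n" "w \<noteq> 0\<^sub>v n" "?B *\<^sub>v w = l \<cdot>\<^sub>v w"
    using B by (auto simp: spectrum_def eigenvalue_def eigenvector_def)
  have eq: "(\<Sum>j<n. of_real (A $$ (i, j)) * w $ j) = l * w $ i" if "i < n" for i
  proof -
    have "(?B *\<^sub>v w) $ i = (\<Sum>j<n. of_real (A $$ (i, j)) * w $ j)"
      using that A w(1) by (auto simp: scalar_prod_def lessThan_atLeast0 intro!: sum.cong)
    then show ?thesis using w that by simp
  qed
  obtain i0 where i0: "i0 < n" "w $ i0 \<noteq> 0"
    using w(1,2) by (metis carrier_vecD eq_vecI index_zero_vec)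
  define r where "r = (\<Sum>i<n. (cmod (w $ i))\<^sup>2)"
  define q where "q = (\<Sum>i<n. \<Sum>j<n. of_real (A $$ (i, j)) * w $ j * cnj (w $ i))"
  have "r > 0" unfolding r_def using i0 by (intro sum_pos2[of _ i0]) auto
  have "q = (\<Sum>i<n. l * w $ i * cnj (w $ i))"
    unfolding q_def sum_distrib_right[symmetric] using eq by (intro sum.cong) auto
  also have "\<dots> = l * of_real r"
    by (simp add: r_def sum_distrib_left mult.assoc complex_norm_square del: of_real_power)
  finally have ql: "q = l * of_real r" .
  have "cnj q = (\<Sum>i<n. \<Sum>j<n. of_real (A $$ (j, i)) * w $ i * cnj (w $ j))"
    unfolding q_def using sym by (auto intro!: sum.cong simp: mult_ac)
  also have "\<dots> = q" unfolding q_def by (rule sum.swap)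
  finally have "cnj l = l" using ql \<open>r > 0\<close> by simp
  then have "Im l = 0" by (simp add: complex_eq_iff)
  then have l: "l = of_real (Re l)" by (simp add: complex_eq_iff)
  \<comment> \<open>Whichever part is nonzero at \<open>i0\<close> is chosen, so that the resulting
    vector does not vanish.\<close>
  define part :: "complex \<Rightarrow> real" where "part = (if Re (w $ i0) \<noteq> 0 then Re else Im)"
  have part: "part (of_real a * z) = a * part z" "part (sum f K) = (\<Sum>k\<in>K. part (f k))" for a z f and K :: "nat set"
    by (auto simp: part_def)
  have "part (w $ i0) \<noteq> 0" using i0(2) by (auto simp: part_def complex_eq_iff)
  let ?x = "vec n (\<lambda>i. part (w $ i))"
  have "A *\<^sub>v ?x = Re l \<cdot>\<^sub>v ?x"
  proof (rule eq_vecI)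
    fix i assume "i < dim_vec (Re l \<cdot>\<^sub>v ?x)"
    then have i: "i < n" by simp
    have "(A *\<^sub>v ?x) $ i = (\<Sum>j<n. A $$ (i, j) * part (w $ j))"
      using i A by (auto simp: scalar_prod_def lessThan_atLeast0 intro!: sum.cong)
    also have "\<dots> = part (\<Sum>j<n. of_real (A $$ (i, j)) * w $ j)" by (simp add: part)
    also have "\<dots> = part (of_real (Re l) * w $ i)" using eq[OF i] l by simp
    finally show "(A *\<^sub>v ?x) $ i = (Re l \<cdot>\<^sub>v ?x) $ i" using i by (simp add: part)
  qed (use A in auto)
  moreover have "?x \<noteq> 0\<^sub>v n"
    using i0(1) \<open>part (w $ i0) \<noteq> 0\<close> by (metis index_vec index_zero_vec(1))
  ultimately have "eigenvalue A (Re l)" using A by (auto simp: eigenvalue_def eigenvector_def intro!: exI[of _ ?x])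
  then show ?thesis by (auto simp: spectrum_def)
qed

text \<open>The degree term is spread over the neighbours as one \<open>x v\<close> per arc, so that
  each equation is a single sum over arcs, independent of any enumeration.\<close>

definition signless_eigenvalue :: "'a pair_pre_digraph \<Rightarrow> real \<Rightarrow> bool" where
  "signless_eigenvalue G l \<longleftrightarrow> (\<exists>x. (\<exists>v\<in>pverts G. x v \<noteq> 0) \<and>
     (\<forall>v\<in>pverts G. (\<Sum>u | (v, u) \<in> parcs G. x v + x u) = l * x v))"

lemma (in pair_graph) finite_out_neighbours: "finite {u. (v, u) \<in> parcs G}"
  by (rule finite_subset[OF _ pair_finite_verts]) (auto dest: in_arcsD2)

lemma (in pair_graph) arc_sym: "(u, v) \<in> parcs G \<Longrightarrow> (v, u) \<in> parcs G"
  using pair_sym_arcs by (auto simp: symmetric_def dest: symD)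

lemma (in pair_graph) out_degree_eq: "out_degree (with_proj G) v = card {u. (v, u) \<in> parcs G}"
proof -
  have "out_arcs (with_proj G) v = Pair v ` {u. (v, u) \<in> parcs G}" by (auto simp: out_arcs_def)
  then show ?thesis by (simp add: out_degree_def card_image inj_on_def)
qed

text \<open>Removes the chosen enumeration; finiteness and nonemptiness make \<open>Max\<close>
  meaningful.\<close>

lemma signless_spectral_radius_Max:
  assumes "pair_graph G" "pverts G \<noteq> {}"
  shows "signless_spectral_radius G = Max {l. signless_eigenvalue G l}"
    and "finite {l. signless_eigenvalue G l}"
    and "{l. signless_eigenvalue G l} \<noteq> {}"
proof -
  interpret pair_graph G by fact
  define vs where "vs = (SOME vs. distinct vs \<and> set vs = pverts G)"
  have "\<exists>vs. distinct vs \<and> set vs = pverts G"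
    using finite_distinct_list[OF pair_finite_verts] by auto
  then have vs: "distinct vs" "set vs = pverts G" unfolding vs_def by (metis (mono_tags, lifting) someI_ex)+
  let ?Q = "signless_laplacian G vs"
  have spec: "spectrum ?Q = {l. signless_eigenvalue G l}"
    unfolding spectrum_signless_laplacian[OF assms(1) vs] signless_eigenvalue_def out_degree_eq
    by (simp add: sum.distrib)
  have Q: "?Q \<in> carrier_mat (length vs) (length vs)"
    by (simp add: signless_laplacian_def degree_mat_def adjacency_mat_def)
  have "length vs > 0" using vs(2) assms(2) by auto
  then have "spectrum ?Q \<noteq> {}"
    by (rule symmetric_real_eigenvalue_exists[OF Q, rotated])
       (auto simp: signless_laplacian_def degree_mat_def adjacency_mat_def dest: arc_sym)
  then show "{l. signless_eigenvalue G l} \<noteq> {}" by (simp add: spec)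
  show "finite {l. signless_eigenvalue G l}" using card_finite_spectrum[OF Q] by (simp add: spec)
  show "signless_spectral_radius G = Max {l. signless_eigenvalue G l}"
    unfolding signless_spectral_radius_def vs_def[symmetric] spec ..
qed

lemma maximal_ratio_exists:
  fixes x y :: "'a \<Rightarrow> real"
  assumes "finite V" "V \<noteq> {}" "\<And>v. v \<in> V \<Longrightarrow> x v > 0" "\<exists>v\<in>V. y v \<noteq> 0"
  obtains c w where "c > 0" "w \<in> V" "\<bar>y w\<bar> = c * x w" "\<And>v. v \<in> V \<Longrightarrow> \<bar>y v\<bar> \<le> c * x v"
proof -
  define c where "c = Max ((\<lambda>v. \<bar>y v\<bar> / x v) ` V)"
  have "c \<in> (\<lambda>v. \<bar>y v\<bar> / x v) ` V" unfolding c_def using assms(1,2) by (intro Max_in) auto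
  then obtain w where w: "w \<in> V" "c = \<bar>y w\<bar> / x w" by auto
  have le: "\<bar>y v\<bar> / x v \<le> c" if "v \<in> V" for v
    unfolding c_def using assms(1) that by (intro Max_ge) auto
  obtain v where v: "v \<in> V" "y v \<noteq> 0" using assms(4) by auto
  have "0 < \<bar>y v\<bar> / x v" using v assms(3)[OF v(1)] by simp
  also note le[OF v(1)]
  finally have "c > 0" .
  moreover have "\<bar>y w\<bar> = c * x w" using w assms(3)[OF w(1)] by simp
  moreover have "\<bar>y u\<bar> \<le> c * x u" if "u \<in> V" for u
    using le[OF that] assms(3)[OF that] by (simp add: field_simps)
  ultimately show thesis using that w(1) by blast
qed

text \<open>The vertices at which an eigenvector attains the largest ratio to the positive
  vector \<open>x\<close> are closed under taking neighbours when the eigenvalue is at least \<open>\<mu>\<close>.\<close>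

lemma maximal_ratio_propagates:
  fixes x y :: "'a \<Rightarrow> real"
  assumes fin: "finite B" "A \<subseteq> B" and x: "\<And>u. u \<in> B \<Longrightarrow> x u > 0" "x v > 0"
    and sub: "(\<Sum>u\<in>B. x v + x u) \<le> \<mu> * x v"
    and eig: "(\<Sum>u\<in>A. y v + y u) = l * y v"
    and c: "c > 0" "\<bar>y v\<bar> = c * x v" "\<And>u. u \<in> B \<Longrightarrow> \<bar>y u\<bar> \<le> c * x u"
  shows "l \<le> \<mu>" and "l = \<mu> \<Longrightarrow> A = B" and "l = \<mu> \<Longrightarrow> u \<in> B \<Longrightarrow> \<bar>y u\<bar> = c * x u"
proof -
  have finA: "finite A" using fin finite_subset by blast
  have "l * (c * x v) \<le> \<bar>l * y v\<bar>" using c(2) abs_ge_self[of l] x(2) c(1) 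
    by (simp add: abs_mult mult_right_mono)
  also have "\<dots> \<le> (\<Sum>u\<in>A. \<bar>y v\<bar> + \<bar>y u\<bar>)"
    unfolding eig[symmetric] by (rule order_trans[OF sum_abs]) (intro sum_mono abs_triangle_ineq)
  finally have 1: "l * (c * x v) \<le> (\<Sum>u\<in>A. \<bar>y v\<bar> + \<bar>y u\<bar>)" .
  have 2: "(\<Sum>u\<in>A. \<bar>y v\<bar> + \<bar>y u\<bar>) \<le> (\<Sum>u\<in>A. c * (x v + x u))"
    using c fin(2) by (intro sum_mono) (auto simp: distrib_left)
  have split: "(\<Sum>u\<in>B. c * (x v + x u)) = (\<Sum>u\<in>A. c * (x v + x u)) + (\<Sum>u\<in>B - A. c * (x v + x u))"
    using fin by (simp add: sum.subset_diff)
  have pos: "c * (x v + x u) > 0" if "u \<in> B" for u using x(1)[OF that] x(2) c(1) by simp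
  then have 3: "(\<Sum>u\<in>B - A. c * (x v + x u)) \<ge> 0" by (intro sum_nonneg) (auto intro: less_imp_le)
  have 4: "(\<Sum>u\<in>B. c * (x v + x u)) \<le> \<mu> * (c * x v)"
    using mult_left_mono[OF sub, of c] c(1) by (simp add: sum_distrib_left[symmetric] mult_ac)
  have "l * (c * x v) \<le> \<mu> * (c * x v)" using 1 2 3 4 split by linarith
  then show "l \<le> \<mu>" using c(1) x(2) by simp
  \<comment> \<open>Equality makes every estimate tight: the positive terms over
    \<open>B - A\<close> must be absent, and each term over \<open>A\<close> is tight
    separately.\<close>
  assume "l = \<mu>"
  then have 5: "(\<Sum>u\<in>B - A. c * (x v + x u)) = 0"
    and 6: "(\<Sum>u\<in>A. c * (x v + x u) - (\<bar>y v\<bar> + \<bar>y u\<bar>)) = 0"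
    using 1 2 3 4 split by (auto simp: sum_subtractf)
  show "A = B"
  proof (rule ccontr)
    assume "A \<noteq> B"
    then have "(\<Sum>u\<in>B - A. c * (x v + x u)) > 0" using fin pos by (intro sum_pos) auto
    with 5 show False by simp
  qed
  moreover have "\<forall>u\<in>A. c * (x v + x u) - (\<bar>y v\<bar> + \<bar>y u\<bar>) = 0"
    using 6 c fin(2) finA by (subst sum_nonneg_eq_0_iff[symmetric]) (auto simp: distrib_left)
  ultimately show "\<bar>y u\<bar> = c * x u" if "u \<in> B" using that c(2) by (auto simp: distrib_left)
qed

text \<open>The bound is read off at a vertex of largest ratio. In the equality case, a vertex
  \<open>p\<close> adjacent in \<open>E\<close> to all others passes the largest ratio on to every
  vertex, which makes all neighbourhoods in \<open>G\<close> and \<open>E\<close> agree.\<close>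

lemma signless_eigenvalue_le:
  assumes "pair_graph G" and x: "\<And>v. v \<in> pverts G \<Longrightarrow> x v > 0"
    and E: "parcs G \<subseteq> E" "E \<subseteq> pverts G \<times> pverts G"
    and sub: "\<And>v. v \<in> pverts G \<Longrightarrow> (\<Sum>u | (v, u) \<in> E. x v + x u) \<le> \<mu> * x v"
    and eig: "signless_eigenvalue G l"
  shows "l \<le> \<mu>"
    and "l = \<mu> \<Longrightarrow> p \<in> pverts G \<Longrightarrow> (\<And>v. v \<in> pverts G - {p} \<Longrightarrow> (v, p) \<in> E \<and> (p, v) \<in> E) \<Longrightarrow> parcs G = E"
proof -
  interpret pair_graph G by fact
  obtain y where y: "\<exists>v\<in>pverts G. y v \<noteq> 0"
    and yeq: "\<And>v. v \<in> pverts G \<Longrightarrow> (\<Sum>u | (v, u) \<in> parcs G. y v + y u) = l * y v"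
    using eig by (auto simp: signless_eigenvalue_def)
  obtain c w where c: "c > 0" "w \<in> pverts G" "\<bar>y w\<bar> = c * x w"
    and le: "\<And>v. v \<in> pverts G \<Longrightarrow> \<bar>y v\<bar> \<le> c * x v"
    using maximal_ratio_exists[of "pverts G" x y] x y pair_finite_verts by blast
  have nbp: "finite {u. (v, u) \<in> E}" "{u. (v, u) \<in> parcs G} \<subseteq> {u. (v, u) \<in> E}"
    "\<And>u. u \<in> {u. (v, u) \<in> E} \<Longrightarrow> x u > 0" "\<And>u. u \<in> {u. (v, u) \<in> E} \<Longrightarrow> \<bar>y u\<bar> \<le> c * x u" for v
    using E x le pair_finite_verts by (auto intro: finite_subset[of _ "pverts G"])
  note step = maximal_ratio_propagates[OF nbp(1-3) x sub yeq c(1) _ nbp(4)]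
  show "l \<le> \<mu>" using step(1)[of w] c by simp
  assume l: "l = \<mu>" and p: "p \<in> pverts G"
    and dom: "\<And>v. v \<in> pverts G - {p} \<Longrightarrow> (v, p) \<in> E \<and> (p, v) \<in> E"
  have nb: "\<bar>y u\<bar> = c * x u" if "v \<in> pverts G" "\<bar>y v\<bar> = c * x v" "(v, u) \<in> E" for u v
    by (rule step(3)[of v]) (use that l in auto)
  have "\<bar>y p\<bar> = c * x p" using nb[of w p] c dom[of w] by (cases "w = p") auto
  then have all: "\<bar>y v\<bar> = c * x v" if "v \<in> pverts G" for v
    using nb[of p v] p dom[of v] that by (cases "v = p") auto
  have "{u. (v, u) \<in> parcs G} = {u. (v, u) \<in> E}" if "v \<in> pverts G" for v
    using step(2)[of v] that all l by simp
  then show "parcs G = E" using E by blast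
qed

section \<open>Bounds from vertex cuts\<close>

text \<open>A class of size \<open>a\<close> contributes \<open>a\<close> terms
  \<open>1 / a\<close>.\<close>

lemma sum_inverse_class_size:
  assumes "finite U"
  shows "(\<Sum>u\<in>U. 1 / real (card {w \<in> U. c w = c u})) = real (card (c ` U))"
proof -
  have "(\<Sum>u\<in>U. 1 / real (card {w \<in> U. c w = c u}))
      = (\<Sum>y\<in>c ` U. \<Sum>u | u \<in> U \<and> c u = y. 1 / real (card {w \<in> U. c w = c u}))"
    by (rule sum.image_gen[OF assms])
  also have "\<dots> = (\<Sum>y\<in>c ` U. 1)"
  proof (rule sum.cong[OF refl])
    fix y assume "y \<in> c ` U"
    then have "card {w \<in> U. c w = y} \<noteq> 0" using assms by auto
    then show "(\<Sum>u | u \<in> U \<and> c u = y. 1 / real (card {w \<in> U. c w = c u})) = 1" by simp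
  qed
  finally show ?thesis by simp
qed

text \<open>Every label other than \<open>y\<close> needs a vertex outside the class of
  \<open>y\<close>.\<close>

lemma class_size_plus_classes_le:
  assumes "finite U"
  shows "card {w \<in> U. c w = y} + card (c ` U) \<le> card U + 1"
    and "card (c ` U) \<le> card (c ` (U - {w \<in> U. c w = y})) + 1"
proof -
  let ?K = "{w \<in> U. c w = y}"
  have "c ` U \<subseteq> insert y (c ` (U - ?K))" by auto
  then have "card (c ` U) \<le> card (insert y (c ` (U - ?K)))"
    using assms by (intro card_mono) auto
  also have "\<dots> \<le> card (c ` (U - ?K)) + 1" using assms by (simp add: card_insert_if)
  finally show le: "card (c ` U) \<le> card (c ` (U - ?K)) + 1" .
  have "card (c ` (U - ?K)) \<le> card (U - ?K)" using assms by (intro card_image_le) auto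
  moreover have "card (U - ?K) = card U - card ?K" using assms by (intro card_Diff_subset) auto
  moreover have "card ?K \<le> card U" using assms by (intro card_mono) auto
  ultimately show "card ?K + card (c ` U) \<le> card U + 1" using le by linarith
qed

text \<open>As a function of \<open>1 / a\<close> the left side is convex, and the right side is its
  chord through \<open>a = 1\<close> and \<open>a = A\<close>. Being affine in \<open>1 / a\<close>,
  the chord can be summed by counting classes.\<close>

lemma inverse_le_chord:
  fixes a A C :: real
  assumes "1 \<le> a" "a \<le> A" "2 * A < C"
  shows "1 / (C - 2 * a) \<le> 1 / (C - 2) * (1 / a * (1 - C / (C - 2 * A)) + C / (C - 2 * A))"
proof -
  have "1 / (C - 2 * a) = 1 / (C - 2) * (1 / a + C * (a - 1) / (a * (C - 2 * a)))"
  proof -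
    have "C - 2 * a \<noteq> 0" "C - 2 \<noteq> 0" "a \<noteq> 0" using assms by auto
    then show ?thesis by (simp add: divide_simps) (simp add: algebra_simps)
  qed
  also have "C * (a - 1) / (a * (C - 2 * a)) \<le> C * (a - 1) / (a * (C - 2 * A))"
    using assms by (intro divide_left_mono mult_left_mono mult_pos_pos mult_nonneg_nonneg) auto
  then have "1 / (C - 2) * (1 / a + C * (a - 1) / (a * (C - 2 * a)))
      \<le> 1 / (C - 2) * (1 / a + C * (a - 1) / (a * (C - 2 * A)))"
    using assms by (intro mult_left_mono add_left_mono) auto
  also have "1 / a + C * (a - 1) / (a * (C - 2 * A)) = 1 / a * (1 - C / (C - 2 * A)) + C / (C - 2 * A)"
  proof -
    have "C - 2 * A \<noteq> 0" "a \<noteq> 0" using assms by auto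
    then show ?thesis by (simp add: divide_simps) (simp add: algebra_simps)
  qed
  finally show ?thesis .
qed

text \<open>The positive vector is \<open>1\<close> on \<open>S\<close> and \<open>|S| / (C - 2a)\<close> on a class of size \<open>a\<close>, the eigenvector
  equation at that class when it is a clique joined to \<open>S\<close>. The chord bound makes its sum depend
  only on the number of classes and the largest class size.\<close>

lemma signless_eigenvalue_le_of_classes:
  fixes c :: "'a \<Rightarrow> 'b" and A C lam T :: real
  assumes "pair_graph G" and S: "S \<subseteq> pverts G" "S \<noteq> {}"
    and cls: "\<And>u v. (u, v) \<in> parcs G \<Longrightarrow> u \<notin> S \<Longrightarrow> v \<notin> S \<Longrightarrow> c u = c v"
    and size: "\<And>v. v \<in> pverts G - S \<Longrightarrow> real (card {u \<in> pverts G - S. c u = c v}) \<le> A"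
    and T: "T \<le> card (c ` (pverts G - S))"
    and A: "1 \<le> A" "2 * A < C"
    and lam: "lam = C + card S - 2"
    and bound: "card S * (T + C * (real (card (pverts G)) - real (card S) - T) / (C - 2 * A))
      \<le> (C - 2) * (lam - card (pverts G) - card S + 2)"
    and eig: "signless_eigenvalue G l"
  shows "l \<le> lam"
proof -
  interpret pair_graph G by fact
  let ?V = "pverts G" let ?U = "?V - S" let ?s = "real (card S)"
  define a where "a v = real (card {u \<in> ?U. c u = c v})" for v
  define x where "x v = (if v \<in> S then 1 else ?s / (C - 2 * a v))" for v
  define \<kappa> where "\<kappa> = C / (C - 2 * A)"
  have finS: "finite S" using S pair_finite_verts finite_subset by blast
  have s: "?s > 0" using finS S(2) by (simp add: card_gt_0_iff)
  have a: "1 \<le> a v" "a v \<le> A" if "v \<in> ?U" for v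
  proof -
    have "card {u \<in> ?U. c u = c v} \<noteq> 0" using that pair_finite_verts by auto
    then show "1 \<le> a v" unfolding a_def by linarith
    show "a v \<le> A" using size[OF that] by (simp add: a_def)
  qed
  have xpos: "x v > 0" if "v \<in> ?V" for v
    using that s a[of v] A by (auto simp: x_def)
  have xle: "x v \<le> ?s * (1 / (C - 2) * (1 / a v * (1 - \<kappa>) + \<kappa>))" if "v \<in> ?U" for v
    using mult_left_mono[OF inverse_le_chord[OF a[OF that] A(2)], of ?s] that s
    by (simp add: x_def \<kappa>_def)
  have "(\<Sum>v\<in>?U. x v) \<le> (\<Sum>v\<in>?U. ?s / (C - 2) * ((1 - \<kappa>) * (1 / a v) + \<kappa>))"
    by (rule sum_mono) (use xle in \<open>simp add: mult_ac\<close>)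
  also have "\<dots> = ?s / (C - 2) * ((1 - \<kappa>) * card (c ` ?U) + \<kappa> * card ?U)"
  proof -
    have "(\<Sum>v\<in>?U. 1 / a v) = card (c ` ?U)"
      using sum_inverse_class_size[of ?U c] pair_finite_verts unfolding a_def by blast
    then have "(\<Sum>v\<in>?U. (1 - \<kappa>) * (1 / a v) + \<kappa>) = (1 - \<kappa>) * card (c ` ?U) + \<kappa> * card ?U"
      by (simp only: sum.distrib sum_distrib_left[symmetric]) simp
    then show ?thesis by (simp only: sum_distrib_left[symmetric])
  qed
  also have "\<dots> \<le> ?s / (C - 2) * ((1 - \<kappa>) * T + \<kappa> * card ?U)"
  proof -
    \<comment> \<open>The number of classes has the nonpositive coefficient
      \<open>1 - \<kappa>\<close>, so its lower bound \<open>T\<close> may replace it.\<close>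
    have "\<kappa> \<ge> 1" using A by (simp add: \<kappa>_def)
    then show ?thesis using A T s by (intro mult_left_mono add_right_mono mult_left_mono_neg) auto
  qed
  also have "real (card ?U) = real (card ?V) - real (card S)"
    using S(1) finS pair_finite_verts by (simp add: card_Diff_subset card_mono of_nat_diff)
  also have "?s / (C - 2) * ((1 - \<kappa>) * T + \<kappa> * (real (card ?V) - real (card S))) \<le> lam - real (card ?V) - real (card S) + 2"
  proof -
    have "(1 - \<kappa>) * T + \<kappa> * (real (card ?V) - real (card S))
      = T + C * (real (card ?V) - real (card S) - T) / (C - 2 * A)" (is "?L = ?R")
      by (simp add: \<kappa>_def algebra_simps diff_divide_distrib add_divide_distrib)
    then have "?s / (C - 2) * ?L = ?s / (C - 2) * ?R" by simp
    also have "\<dots> \<le> lam - real (card ?V) - real (card S) + 2"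
      using bound A by (simp add: divide_simps mult_ac)
    finally show ?thesis .
  qed
  finally have sumU: "(\<Sum>v\<in>?U. x v) \<le> lam - real (card ?V) - real (card S) + 2" .
  have sum_le: "(\<Sum>u | (v, u) \<in> parcs G. x v + x u) \<le> lam * x v" if v: "v \<in> ?V" for v
  proof -
    have nonneg: "0 \<le> x v + x u" if "u \<in> ?V" for u using xpos[OF v] xpos[OF that] by simp
    show ?thesis
    proof (cases "v \<in> S")
      case True
      \<comment> \<open>A vertex of \<open>S\<close> is treated as adjacent to all others; its own
        term \<open>1 + x v = 2\<close> is then taken off.\<close>
      have "(\<Sum>u | (v, u) \<in> parcs G. x v + x u) \<le> (\<Sum>u\<in>?V - {v}. x v + x u)"
        using pair_finite_verts
        by (intro sum_mono2) (auto dest: in_arcsD2 no_loops' intro: nonneg)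
      also have "\<dots> = (\<Sum>u\<in>?V. 1 + x u) - 2"
        using sum.remove[OF pair_finite_verts v, of "\<lambda>u. 1 + x u"] True by (simp add: x_def)
      also have "(\<Sum>u\<in>?V. 1 + x u) = card ?V + ((\<Sum>u\<in>?U. x u) + (\<Sum>u\<in>S. x u))"
        using S(1) pair_finite_verts by (simp add: sum.distrib sum.subset_diff)
      also have "(\<Sum>u\<in>S. x u) = card S" by (simp add: x_def)
      finally show ?thesis using sumU True by (simp add: x_def)
    next
      case False
      then have vU: "v \<in> ?U" using v by simp
      let ?K = "{u \<in> ?U. c u = c v}"
      have "(\<Sum>u | (v, u) \<in> parcs G. x v + x u) \<le> (\<Sum>u\<in>S \<union> (?K - {v}). x v + x u)"
        using pair_finite_verts finS S False cls[of v]
        by (intro sum_mono2) (auto dest: in_arcsD2 no_loops' intro!: nonneg)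
      also have "\<dots> = (\<Sum>u\<in>S. x v + x u) + (\<Sum>u\<in>?K - {v}. x v + x u)"
        using finS pair_finite_verts by (intro sum.union_disjoint) auto
      also have "(\<Sum>u\<in>S. x v + x u) = card S * (x v + 1)" by (simp add: x_def)
      also have "(\<Sum>u\<in>?K - {v}. x v + x u) = (\<Sum>u\<in>?K - {v}. 2 * x v)"
        using False by (intro sum.cong) (auto simp: x_def a_def)
      also have "\<dots> = (a v - 1) * (2 * x v)"
      proof -
        have "Suc (card (?K - {v})) = card ?K"
          using vU pair_finite_verts by (intro card_Suc_Diff1) auto
        then have "real (card (?K - {v})) = a v - 1" unfolding a_def by linarith
        then show ?thesis by simp
      qed
      also have "card S * (x v + 1) + (a v - 1) * (2 * x v) = lam * x v"
      proof -
        have "(C - 2 * a v) * x v = ?s" using a[OF vU] A False by (simp add: x_def)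
        then show ?thesis unfolding lam by (simp add: algebra_simps)
      qed
      finally show ?thesis .
    qed
  qed
  show ?thesis
  proof (rule signless_eigenvalue_le(1)[OF assms(1) xpos _ _ sum_le eig])
    show "parcs G \<subseteq> ?V \<times> ?V" by (auto dest: in_arcsD1 in_arcsD2)
  qed auto
qed

text \<open>This is the condition of the previous lemma for \<open>|S| = s \<ge> 3\<close>, \<open>n = 2s + k + R\<close> and
  \<open>lam = 2(n - k - 2)\<close>. It is an equality for \<open>R = 0\<close> and \<open>n = 5k + 8\<close>, which is where the bound
  on \<open>n\<close> comes from.\<close>

lemma cut_bound_arith:
  fixes s k R :: real
  assumes "3 \<le> s" "0 \<le> R" "4 * k + 8 \<le> 2 * s + R"
  shows "s * (s + k + (3 * s + 2 * R - 2) * R / (3 * s - 4)) \<le> (3 * s + 2 * R - 4) * (s + R - k - 2)"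
proof -
  \<comment> \<open>\<open>D\<close> is the right side minus the left after multiplication by
    \<open>3 * s - 4\<close>. In \<open>D4\<close> the third hypothesis is exactly the sign of the
    last factor.\<close>
  define D where "D = (3 * s - 4) * ((3 * s + 2 * R - 4) * (s + R - k - 2) - s * (s + k)) - s * R * (3 * s + 2 * R - 2)"
  have D4: "4 * D = R * (24 * s^2 - 76 * s + 48 + R * (10 * s - 24))
      + (3 * s - 4) * (4 * s + 2 * R - 4) * (2 * s + R - 8 - 4 * k)"
    unfolding D_def by (simp add: algebra_simps power2_eq_square)
  have "24 * s^2 - 76 * s + 48 = (s - 3) * (24 * s - 4) + 36"
    by (simp add: algebra_simps power2_eq_square)
  moreover have "(s - 3) * (24 * s - 4) \<ge> 0" using assms by (intro mult_nonneg_nonneg) auto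
  ultimately have "24 * s^2 - 76 * s + 48 \<ge> 0" by linarith
  then have "R * (24 * s^2 - 76 * s + 48 + R * (10 * s - 24)) \<ge> 0"
    and "(3 * s - 4) * (4 * s + 2 * R - 4) * (2 * s + R - 8 - 4 * k) \<ge> 0"
    using assms by (auto intro!: mult_nonneg_nonneg add_nonneg_nonneg)
  with D4 have "D \<ge> 0" by linarith
  have "(s * (s + k + (3 * s + 2 * R - 2) * R / (3 * s - 4))) * (3 * s - 4)
      = s * (s + k) * (3 * s - 4) + s * R * (3 * s + 2 * R - 2)"
    using assms by (simp add: field_simps)
  also have "\<dots> \<le> (3 * s + 2 * R - 4) * (s + R - k - 2) * (3 * s - 4)"
    using \<open>D \<ge> 0\<close> by (simp add: D_def algebra_simps)
  finally show ?thesis using assms by (simp add: mult_le_cancel_right)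
qed

section \<open>The extremal graph\<close>

text \<open>For \<open>card S = 2\<close> these are the arcs of \<open>K\<^sub>2 \<or> (m K\<^sub>1 \<union> K\<^sub>b)\<close> with \<open>S\<close> as the \<open>K\<^sub>2\<close> and \<open>B\<close> as the
  \<open>K\<^sub>b\<close>; \<open>joined_weight\<close> is its Perron vector if \<open>\<mu>\<close> is its spectral radius.\<close>

definition joined_arcs :: "'a set \<Rightarrow> 'a set \<Rightarrow> 'a set \<Rightarrow> ('a \<times> 'a) set" where
  "joined_arcs V S B = {(u, v). u \<in> V \<and> v \<in> V \<and> u \<noteq> v \<and> (u \<in> S \<or> v \<in> S \<or> u \<in> B \<and> v \<in> B)}"

definition joined_weight :: "'a set \<Rightarrow> 'a set \<Rightarrow> real \<Rightarrow> 'a \<Rightarrow> real" where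
  "joined_weight S B \<mu> v = (if v \<in> S then 1 else if v \<in> B then 2 / (\<mu> - 2 * card B) else 2 / (\<mu> - 2))"

text \<open>The weights solve \<open>2 * card B * x + 2 = \<mu> * x\<close> on \<open>B\<close> and
  \<open>2 * x + 2 = \<mu> * x\<close> outside \<open>S\<close> and \<open>B\<close>. What remains
  is the equation on \<open>S\<close>, which is the last condition on \<open>\<mu>\<close>.\<close>

lemma joined_weight_eigen:
  fixes \<mu> :: real
  assumes fin: "finite V" and SB: "S \<subseteq> V" "B \<subseteq> V" "S \<inter> B = {}" "card S = 2"
    and \<mu>: "\<mu> \<noteq> 2" "\<mu> \<noteq> 2 * card B"
      "card V + 2 * (real (card V) - 2 - real (card B)) / (\<mu> - 2) + 2 * card B / (\<mu> - 2 * card B) = \<mu>"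
    and v: "v \<in> V"
  shows "(\<Sum>u | (v, u) \<in> joined_arcs V S B. joined_weight S B \<mu> v + joined_weight S B \<mu> u)
    = \<mu> * joined_weight S B \<mu> v"
proof -
  let ?x = "joined_weight S B \<mu>"
  have finSB: "finite S" "finite B" using fin SB finite_subset by blast+
  have xS: "(\<Sum>u\<in>S. ?x u) = 2" using SB by (simp add: joined_weight_def)
  have "(\<Sum>u\<in>B. ?x u) = (\<Sum>u\<in>B. 2 / (\<mu> - 2 * card B))"
    using SB(3) by (intro sum.cong) (auto simp: joined_weight_def)
  then have xB: "(\<Sum>u\<in>B. ?x u) = 2 * card B / (\<mu> - 2 * card B)" by simp
  have "v \<in> S \<or> v \<in> B \<or> v \<in> V - S - B" using v by auto
  then consider "v \<in> S" | "v \<in> B" "v \<notin> S" | "v \<notin> S" "v \<notin> B" using SB by auto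
  then show ?thesis
  proof cases
    case 1
    have "{u. (v, u) \<in> joined_arcs V S B} = V - {v}" using 1 v by (auto simp: joined_arcs_def)
    moreover have "(\<Sum>u\<in>V. 1 + ?x u) = 2 + (\<Sum>u\<in>V - {v}. 1 + ?x u)"
      using sum.remove[OF fin v, of "\<lambda>u. 1 + ?x u"] 1 by (simp add: joined_weight_def)
    moreover have "?x v = 1" using 1 by (simp add: joined_weight_def)
    ultimately have "(\<Sum>u | (v, u) \<in> joined_arcs V S B. ?x v + ?x u) = (\<Sum>u\<in>V. 1 + ?x u) - 2"
      by simp
    also have "(\<Sum>u\<in>V. 1 + ?x u) = card V + (\<Sum>u\<in>V - S - B. ?x u) + (\<Sum>u\<in>B. ?x u) + (\<Sum>u\<in>S. ?x u)"
      using SB fin sum.subset_diff[of S V ?x] sum.subset_diff[of B "V - S" ?x]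
      by (simp add: sum.distrib Int_commute Diff_eq) blast
    also have "(\<Sum>u\<in>V - S - B. ?x u) = card (V - S - B) * (2 / (\<mu> - 2))"
      by (simp add: joined_weight_def)
    also have "real (card (V - S - B)) = real (card V) - 2 - real (card B)"
    proof -
      have "card (S \<union> B) = 2 + card B" using SB finSB by (simp add: card_Un_disjoint)
      moreover have "card (S \<union> B) \<le> card V" using SB fin by (intro card_mono) auto
      moreover have "V - S - B = V - (S \<union> B)" by auto
      ultimately show ?thesis using SB finSB by (simp add: card_Diff_subset)
    qed
    finally show ?thesis using \<mu>(3) 1 xS xB by (simp add: joined_weight_def mult_ac)
  next
    case 2
    have nb: "{u. (v, u) \<in> joined_arcs V S B} = S \<union> (B - {v})" using 2 v SB by (auto simp: joined_arcs_def)
    have "(\<Sum>u | (v, u) \<in> joined_arcs V S B. ?x v + ?x u)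
        = (\<Sum>u\<in>S. ?x v + ?x u) + (\<Sum>u\<in>B - {v}. ?x v + ?x u)"
      unfolding nb using finSB SB by (intro sum.union_disjoint) auto
    also have "(\<Sum>u\<in>S. ?x v + ?x u) = 2 * ?x v + 2" using xS SB by (simp add: sum.distrib)
    also have "(\<Sum>u\<in>B - {v}. ?x v + ?x u) = (\<Sum>u\<in>B. ?x v + ?x u) - 2 * ?x v"
      using sum.remove[OF finSB(2) 2(1), of "\<lambda>u. ?x v + ?x u"] by simp
    also have "(\<Sum>u\<in>B. ?x v + ?x u) = card B * ?x v + 2 * card B / (\<mu> - 2 * card B)"
      using xB by (simp add: sum.distrib)
    also have "2 * card B / (\<mu> - 2 * card B) = card B * ?x v"
      using 2 by (simp add: joined_weight_def)
    finally have "(\<Sum>u | (v, u) \<in> joined_arcs V S B. ?x v + ?x u) = 2 * card B * ?x v + 2"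
      by simp
    moreover have xv: "?x v = 2 / (\<mu> - 2 * card B)" using 2 by (simp add: joined_weight_def)
    have "(\<mu> - 2 * card B) * ?x v = 2"
      unfolding xv times_divide_eq_right using \<mu>(2) by (intro nonzero_mult_div_cancel_left) simp
    ultimately show ?thesis using \<open>(\<mu> - 2 * card B) * ?x v = 2\<close> by (simp add: algebra_simps)
  next
    case 3
    have "{u. (v, u) \<in> joined_arcs V S B} = S" using 3 v SB by (auto simp: joined_arcs_def)
    then have "(\<Sum>u | (v, u) \<in> joined_arcs V S B. ?x v + ?x u) = 2 * ?x v + 2"
      using xS SB by (simp add: sum.distrib)
    then show ?thesis using 3 \<mu>(1) by (simp add: joined_weight_def field_simps)
  qed
qed

text \<open>Intermediate values between \<open>2 * a + 2\<close>, the spectral radius of a clique on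
  \<open>a + 2\<close> vertices, and \<open>2 * n\<close>. At the left end \<open>f\<close> is
  positive because \<open>n\<close> exceeds \<open>a + 2\<close>, hence the strict
  inequality.\<close>

lemma joined_eigenvalue_exists:
  fixes a n :: nat
  assumes "1 \<le> a" "a + 3 \<le> n"
  shows "\<exists>\<mu>::real. 2 * a + 2 < \<mu> \<and> n + 2 * (real n - 2 - real a) / (\<mu> - 2) + 2 * real a / (\<mu> - 2 * real a) = \<mu>"
proof -
  define f where "f \<mu> = n + 2 * (real n - 2 - real a) / (\<mu> - 2) + 2 * real a / (\<mu> - 2 * real a) - \<mu>" for \<mu> :: real
  have n: "real n \<ge> a + 3" "real a \<ge> 1" using assms by linarith+
  have "f (2 * real a + 2) = n - a - 2 + (real n - 2 - real a) / a" using n by (simp add: f_def field_simps)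
  moreover have "(real n - 2 - real a) / a > 0" using n by simp
  ultimately have f0: "f (2 * real a + 2) > 0" using n by linarith
  have "2 * (real n - 2 - real a) / (2 * real n - 2) \<le> 1" using n by (simp add: divide_simps)
  moreover have "2 * real a / (2 * real n - 2 * real a) \<le> a / 3" using n
    by (simp add: divide_simps)
  ultimately have f1: "f (2 * real n) \<le> 0" unfolding f_def using n by linarith
  have "\<exists>\<mu>. 2 * real a + 2 \<le> \<mu> \<and> \<mu> \<le> 2 * real n \<and> f \<mu> = 0"
  proof (rule IVT2')
    show "continuous_on {2 * real a + 2..2 * real n} f"
      unfolding f_def using n by (intro continuous_intros) auto
  qed (use f0 f1 n in auto)
  then obtain \<mu> where \<mu>: "2 * real a + 2 \<le> \<mu>" "f \<mu> = 0" by blast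
  moreover have "\<mu> \<noteq> 2 * real a + 2" using f0 \<mu>(2) by auto
  ultimately show ?thesis by (intro exI[of _ \<mu>]) (simp add: f_def)
qed

text \<open>Adjacency of distinct vertices depends only on which of the three parts contain them, so
  bijections between corresponding parts glue to an isomorphism.\<close>

lemma joined_graph_iso:
  assumes G: "pair_graph G" and arcs: "parcs G = joined_arcs (pverts G) S B" "parcs H = joined_arcs (pverts H) S' B'"
    and sub: "S \<subseteq> pverts G" "B \<subseteq> pverts G" "S \<inter> B = {}" "S' \<subseteq> pverts H" "B' \<subseteq> pverts H" "S' \<inter> B' = {}"
    and card: "card S = card S'" "card B = card B'" "card (pverts G) = card (pverts H)" "finite (pverts H)"
  shows "graph_iso G H"
proof -
  interpret pair_graph G by fact
  let ?V = "pverts G" and ?W = "pverts H"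
  have fin: "finite S" "finite B" "finite S'" "finite B'"
    using sub card(4) pair_finite_verts finite_subset by blast+
  have "B \<subseteq> ?V - S" "B' \<subseteq> ?W - S'" using sub by auto
  then have "card (?V - S - B) = card ?V - card S - card B" "card (?W - S' - B') = card ?W - card S' - card B'"
    using fin sub \<open>B \<subseteq> ?V - S\<close> \<open>B' \<subseteq> ?W - S'\<close> by (simp_all add: card_Diff_subset)
  then have "card (?V - S - B) = card (?W - S' - B')" using card by simp
  then obtain f1 f2 f3 where f: "bij_betw f1 S S'" "bij_betw f2 B B'" "bij_betw f3 (?V - S - B) (?W - S' - B')"
    using fin card pair_finite_verts by (metis finite_same_card_bij finite_Diff)
  define f where "f v = (if v \<in> S then f1 v else if v \<in> B then f2 v else f3 v)" for v
  have fS: "bij_betw f S S'" using f(1) by (subst bij_betw_cong[of _ _ f1]) (auto simp: f_def)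
  have fB: "bij_betw f B B'" using f(2) sub(3) by (subst bij_betw_cong[of _ _ f2]) (auto simp: f_def)
  have "bij_betw f (?V - S - B) (?W - S' - B')"
    using f(3) by (subst bij_betw_cong[of _ _ f3]) (auto simp: f_def)
  then have "bij_betw f (S \<union> B \<union> (?V - S - B)) (S' \<union> B' \<union> (?W - S' - B'))"
    using fS fB sub by (intro bij_betw_combine) auto
  moreover have "S \<union> B \<union> (?V - S - B) = ?V" "S' \<union> B' \<union> (?W - S' - B') = ?W" using sub by auto
  ultimately have fV: "bij_betw f ?V ?W" by simp
  then have inj: "inj_on f ?V" and im: "f ` ?V = ?W" by (auto simp: bij_betw_def)
  have memS: "f v \<in> S' \<longleftrightarrow> v \<in> S" and memB: "f v \<in> B' \<longleftrightarrow> v \<in> B" if "v \<in> ?V" for v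
    using fS fB inj sub that by (auto simp: bij_betw_def inj_on_def)
  have arcs_im: "map_prod f f ` parcs G = parcs H"
  proof (intro equalityI subsetI)
    fix e assume "e \<in> map_prod f f ` parcs G"
    then show "e \<in> parcs H"
      using inj im memS memB by (auto simp: arcs joined_arcs_def inj_on_def)
  next
    fix e assume e: "e \<in> parcs H"
    then have "e \<in> map_prod f f ` (?V \<times> ?V)"
      unfolding map_prod_surj_on[OF im im] by (auto simp: arcs joined_arcs_def)
    then obtain u v where "u \<in> ?V" "v \<in> ?V" "e = (f u, f v)" by auto
    then show "e \<in> map_prod f f ` parcs G"
      using e memS memB by (intro image_eqI[of _ _ "(u, v)"]) (auto simp: arcs joined_arcs_def)
  qed
  let ?h = "\<lparr>iso_verts = f, iso_arcs = map_prod f f, iso_head = snd, iso_tail = fst\<rparr>"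
  have "inj_on (map_prod f f) (parcs G)"
    by (rule inj_on_subset[OF map_prod_inj_on[OF inj inj]]) (auto dest: in_arcsD1 in_arcsD2)
  then have "pre_digraph.digraph_isomorphism (with_proj G) ?h"
    unfolding pre_digraph.digraph_isomorphism_def using inj wf_digraph_wp_iff[of G] pair_wf_digraph by auto
  moreover have "with_proj H = app_iso ?h (with_proj G)"
    using im arcs_im by (intro pre_digraph.equality) auto
  ultimately show ?thesis unfolding graph_iso_def digraph_iso_def by blast
qed

text \<open>Applied to the extremal graph, this bounds its spectral radius below by
  \<open>\<mu>\<close>.\<close>

lemma signless_eigenvalue_joined:
  fixes \<mu> :: real
  assumes "parcs G = joined_arcs (pverts G) S B" "finite (pverts G)"
    and "S \<subseteq> pverts G" "B \<subseteq> pverts G" "S \<inter> B = {}" "card S = 2" and \<mu>: "2 < \<mu>" "2 * card B < \<mu>"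
      "card (pverts G) + 2 * (real (card (pverts G)) - 2 - real (card B)) / (\<mu> - 2)
        + 2 * card B / (\<mu> - 2 * card B) = \<mu>"
  shows "signless_eigenvalue G \<mu>"
  unfolding signless_eigenvalue_def
proof (intro exI[of _ "joined_weight S B \<mu>"] conjI ballI)
  obtain p where "p \<in> S" using assms(6) by fastforce
  then show "\<exists>v\<in>pverts G. joined_weight S B \<mu> v \<noteq> 0"
    using assms(3) by (intro bexI[of _ p]) (auto simp: joined_weight_def)
qed (use assms joined_weight_eigen[of "pverts G" S B \<mu>] in simp)

text \<open>The positive weights are an exact eigenvector of the larger graph, and any vertex of
  \<open>S\<close> is adjacent there to all others, as the equality case requires.\<close>

lemma signless_eigenvalue_joined_le:
  fixes \<mu> :: real
  assumes "pair_graph G" "parcs G \<subseteq> joined_arcs (pverts G) S B"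
    and SB: "S \<subseteq> pverts G" "B \<subseteq> pverts G" "S \<inter> B = {}" "card S = 2" and \<mu>: "2 < \<mu>" "2 * card B < \<mu>"
      "card (pverts G) + 2 * (real (card (pverts G)) - 2 - real (card B)) / (\<mu> - 2)
        + 2 * card B / (\<mu> - 2 * card B) = \<mu>"
    and eig: "signless_eigenvalue G l"
  shows "l \<le> \<mu>" and "l = \<mu> \<Longrightarrow> parcs G = joined_arcs (pverts G) S B"
proof -
  interpret pair_graph G by fact
  have x: "joined_weight S B \<mu> v > 0" for v using \<mu> by (simp add: joined_weight_def)
  have E: "joined_arcs (pverts G) S B \<subseteq> pverts G \<times> pverts G" by (auto simp: joined_arcs_def)
  have sum: "(\<Sum>u | (v, u) \<in> joined_arcs (pverts G) S B. joined_weight S B \<mu> v + joined_weight S B \<mu> u)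
      \<le> \<mu> * joined_weight S B \<mu> v" if "v \<in> pverts G" for v
    using joined_weight_eigen[OF pair_finite_verts SB _ _ \<mu>(3) that] \<mu>(1,2) by simp
  note le = signless_eigenvalue_le[OF assms(1) x assms(2) E sum eig]
  show "l \<le> \<mu>" by (rule le(1))
  obtain p where p: "p \<in> S" using SB(4) by fastforce
  show "parcs G = joined_arcs (pverts G) S B" if "l = \<mu>"
    by (rule le(2)[OF _ that, of p]) (use p SB(1) in \<open>auto simp: joined_arcs_def\<close>)
qed

lemma pair_graph_joined:
  assumes "parcs G = joined_arcs (pverts G) S B" "finite (pverts G)"
  shows "pair_graph G"
proof
  have arcs: "(u, v) \<in> parcs G \<Longrightarrow> u \<in> pverts G \<and> v \<in> pverts G \<and> u \<noteq> v \<and> (v, u) \<in> parcs G" for u v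
    by (simp add: assms(1) joined_arcs_def disj_ac conj_ac) blast
  show "fst e \<in> pverts G" "snd e \<in> pverts G" "fst e \<noteq> snd e" if "e \<in> parcs G" for e
    using arcs[of "fst e" "snd e"] that by simp_all
  show "finite (pverts G)" by (rule assms(2))
  have "parcs G \<subseteq> pverts G \<times> pverts G" by (auto dest: arcs)
  then show "finite (parcs G)" by (rule finite_subset) (simp add: assms(2))
  show "symmetric (with_proj G)" using arcs by (auto simp: symmetric_def intro: symI)
qed

text \<open>The \<open>k + 1\<close> one-vertex copies are the vertices outside \<open>S\<close> and
  \<open>B\<close>.\<close>

lemma extremal_graph_joined:
  fixes k m :: nat
  assumes H_def: "H = graph_join (complete_graph 2)
      (disj_union (copies (k + 1) (complete_graph 1)) (complete_graph m))"
    and S_def: "S = Inl ` {..<2}" and B_def: "B = Inr ` Inr ` {..<m}"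
  shows "pair_graph H" "parcs H = joined_arcs (pverts H) S B" "S \<subseteq> pverts H" "B \<subseteq> pverts H"
    "S \<inter> B = {}" "card S = 2" "card B = m" "card (pverts H) = m + k + 3" "finite (pverts H)"
proof -
  have V: "pverts H = {..<2} <+> ({..<k + 1} \<times> {..<1}) <+> {..<m}"
    by (simp add: H_def graph_join_def disj_union_def complete_graph_def copies_def)
  show arcs: "parcs H = joined_arcs (pverts H) S B"
    unfolding V
    by (auto simp: H_def S_def B_def graph_join_def disj_union_def complete_graph_def copies_def joined_arcs_def
      image_iff map_prod_def split: prod.splits)
  show fin: "finite (pverts H)" by (simp add: V)
  show "pair_graph H" using arcs fin by (rule pair_graph_joined)
  show "card (pverts H) = m + k + 3" by (simp add: V card_Plus)
  show "S \<subseteq> pverts H" "B \<subseteq> pverts H" "S \<inter> B = {}" by (auto simp: V S_def B_def)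
  show "card S = 2" "card B = m" by (simp_all add: S_def B_def card_image)
qed

section \<open>Barriers for matchings through a fixed edge\<close>

text \<open>A matching avoiding the ends of \<open>e\<close> can be trimmed and extended by
  \<open>e\<close>, so it has at most \<open>(n - k) / 2 - 2\<close> edges. Tutte--Berge without
  these ends then gives \<open>card S + k + 2\<close> labels, and adding both ends to the barrier
  absorbs the 2.\<close>

lemma edge_avoiding_matchings_obstruction:
  assumes "pair_graph G" and n: "card (pverts G) = n" "k + 2 \<le> n" "n mod 2 = k mod 2"
    and e: "e \<in> uedges G"
    and none: "\<nexists>M. matching G M \<and> card M = (n - k) div 2 \<and> e \<in> M"
  obtains S and c :: "'a \<Rightarrow> 'a set" where "S \<subseteq> pverts G" "2 \<le> card S"
    "\<And>u v. (u, v) \<in> parcs G \<Longrightarrow> u \<notin> S \<Longrightarrow> v \<notin> S \<Longrightarrow> c u = c v"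
    "card S + k \<le> card (c ` (pverts G - S))"
proof -
  interpret pair_graph G by fact
  let ?V = "pverts G - e" let ?E = "{f \<in> uedges G. f \<inter> e = {}}"
  have edge: "f \<subseteq> pverts G \<and> card f = 2" if "f \<in> uedges G" for f
    using that by (auto simp: uedges_def card_2_iff dest: in_arcsD1 in_arcsD2 no_loops')
  have fine: "finite e" "card e = 2" "e \<subseteq> pverts G"
    using edge[OF e] by (auto intro: card_ge_0_finite)
  have "\<exists>M S (c :: 'a \<Rightarrow> 'a set). is_matching ?E M \<and> S \<subseteq> ?V
    \<and> (\<forall>u v. {u, v} \<in> ?E \<longrightarrow> u \<notin> S \<longrightarrow> v \<notin> S \<longrightarrow> c u = c v)
    \<and> card ?V + card S \<le> 2 * card M + card (c ` (?V - S))"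
    using pair_finite_verts edge by (intro tutte_berge) blast+
  then obtain M S and c :: "'a \<Rightarrow> 'a set" where M: "is_matching ?E M" and S: "S \<subseteq> ?V"
    and c: "\<And>u v. {u, v} \<in> ?E \<Longrightarrow> u \<notin> S \<Longrightarrow> v \<notin> S \<Longrightarrow> c u = c v"
    and le: "card ?V + card S \<le> 2 * card M + card (c ` (?V - S))" by blast
  have finM: "finite M"
  proof (rule finite_subset)
    show "M \<subseteq> Pow (pverts G)" using M edge by (auto simp: is_matching_def)
  qed (simp add: pair_finite_verts)
  have Me: "e \<notin> M" using M fine(2) by (force simp: is_matching_def)
  have "card M < (n - k) div 2 - 1"
  proof (rule ccontr)
    assume "\<not> ?thesis"
    then obtain M' where M': "M' \<subseteq> M" "card M' = (n - k) div 2 - 1"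
      by (metis not_less obtain_subset_with_card_n)
    have "is_matching (uedges G) M'" "e \<inter> \<Union>M' = {}"
      using M M'(1) pairwise_subset[of disjnt M M'] by (auto simp: is_matching_def)
    then have "matching G (insert e M')"
      using is_matching_insert[OF _ e] by (simp add: matching_def is_matching_def disjoint_def)
    moreover have "card (insert e M') = Suc (card M')"
      using M'(1) Me finM by (intro card_insert_disjoint) (auto intro: finite_subset)
    then have "card (insert e M') = (n - k) div 2" using M'(2) n(2) by simp
    ultimately show False using none by blast
  qed
  \<comment> \<open>Equal parity makes the halving exact, so no unit is lost in the count.\<close>
  moreover have "2 * ((n - k) div 2) = n - k"
    using mod_eq_dvd_iff_nat[where m = n and n = k and q = 2] n(2,3) by simp
  ultimately have cM: "2 * card M + k + 4 \<le> n" by linarith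
  have cV: "card ?V = n - 2" using fine n(1) by (simp add: card_Diff_subset)
  have finS: "finite S" using S pair_finite_verts by (meson finite_Diff finite_subset)
  have cS: "card (S \<union> e) = card S + 2" using S fine finS by (subst card_Un_disjoint) auto
  have VS: "?V - S = pverts G - (S \<union> e)" by auto
  show thesis
  proof (rule that[of "S \<union> e" c])
    show "S \<union> e \<subseteq> pverts G" using S fine(3) by auto
    show "2 \<le> card (S \<union> e)" by (simp add: cS)
    show "c u = c v" if "(u, v) \<in> parcs G" "u \<notin> S \<union> e" "v \<notin> S \<union> e" for u v
      using that by (intro c) (auto simp: uedges_def)
    show "card (S \<union> e) + k \<le> card (c ` (pverts G - (S \<union> e)))"
      using le cM cS n(2) unfolding cV VS by linarith
  qed
qed

section \<open>Case distinction by the size of the barrier\<close>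

theorem theorem1p2:
  fixes G :: "'a pair_pre_digraph" and k n :: nat
  defines "H \<equiv> graph_join (complete_graph 2)
                  (disj_union (copies (k + 1) (complete_graph 1)) (complete_graph (n - k - 3)))"
  assumes "pair_graph G"
    and "card (pverts G) = n"
    and "n \<ge> 5 * k + 7"
    and "n mod 2 = k mod 2"
    and "signless_spectral_radius G \<ge> signless_spectral_radius H"
    and "\<not> graph_iso G H"
  shows "\<forall>e \<in> uedges G. \<exists>M. matching G M \<and> card M = (n - k) div 2 \<and> e \<in> M"
proof (rule ballI, rule ccontr)
  fix e assume e: "e \<in> uedges G" and none: "\<nexists>M. matching G M \<and> card M = (n - k) div 2 \<and> e \<in> M"
  interpret pair_graph G by fact
  \<comment> \<open>The number \<open>5 * k + 7\<close> has the opposite parity to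
    \<open>k\<close>.\<close>
  have n8: "5 * k + 8 \<le> n"
  proof (rule ccontr)
    assume "\<not> ?thesis"
    then have "n = k + 2 * (2 * k + 3) + 1" using assms(4) by simp
    then show False using assms(5) by presburger
  qed
  \<comment> \<open>The order of the large clique in \<open>H\<close>; thus
    \<open>2 * a + 2 = 2 * (n - k - 2)\<close>.\<close>
  define a where "a = n - k - 3"
  have na: "n = a + k + 3" "4 * k + 5 \<le> a" using n8 by (auto simp: a_def)
  obtain \<mu> :: real where \<mu>: "2 * a + 2 < \<mu>"
    "n + 2 * (real n - 2 - real a) / (\<mu> - 2) + 2 * real a / (\<mu> - 2 * real a) = \<mu>"
    using joined_eigenvalue_exists[of a n] na by auto
  have "H = graph_join (complete_graph 2) (disj_union (copies (k + 1) (complete_graph 1)) (complete_graph a))"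
    by (simp only: H_def a_def)
  note H = extremal_graph_joined[OF this refl refl]
  have cH: "card (pverts H) = n" using H(8) na by simp
  have "signless_eigenvalue H \<mu>"
    by (rule signless_eigenvalue_joined[OF H(2,9,3-6)]) (use \<mu> H(7) cH in auto)
  moreover have "pverts H \<noteq> {}" using cH na by auto
  ultimately have muH: "\<mu> \<le> signless_spectral_radius H"
    using signless_spectral_radius_Max[OF H(1)] by simp
  define l where "l = signless_spectral_radius G"
  have "pverts G \<noteq> {}" using assms(3) na by auto
  then have eig: "signless_eigenvalue G l"
    using signless_spectral_radius_Max[OF assms(2)] Max_in[of "{l. signless_eigenvalue G l}"]
    by (auto simp: l_def)
  have l: "\<mu> \<le> l" using muH assms(6) by (simp add: l_def)
  then have lbig: "\<not> l \<le> 2 * a + 2" using \<mu>(1) by simp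
  obtain S and c :: "'a \<Rightarrow> 'a set" where S: "S \<subseteq> pverts G" "2 \<le> card S"
    and c: "\<And>u v. (u, v) \<in> parcs G \<Longrightarrow> u \<notin> S \<Longrightarrow> v \<notin> S \<Longrightarrow> c u = c v"
    and classes: "card S + k \<le> card (c ` (pverts G - S))"
    using edge_avoiding_matchings_obstruction[OF assms(2,3) _ assms(5) e none] na by auto
  let ?U = "pverts G - S"
  define s where "s = card S"
  \<comment> \<open>The excess of the vertices outside \<open>S\<close> over the guaranteed
    \<open>s + k\<close> classes, so a class has at most \<open>R + 1\<close> vertices. By
    \<open>nR\<close> the subtraction is not truncated.\<close>
  define R where "R = n - 2 * s - k"
  have finU: "finite ?U" using pair_finite_verts by simp
  have cU: "card ?U = n - s"
    using S(1) assms(3) finite_subset[OF S(1) pair_finite_verts] by (simp add: card_Diff_subset s_def)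
  have "s \<le> n" using card_mono[OF pair_finite_verts S(1)] assms(3) by (simp add: s_def)
  moreover have "s + k \<le> n - s" using classes card_image_le[OF finU, of c] by (simp add: cU s_def)
  ultimately have nR: "n = 2 * s + k + R" by (simp add: R_def)
  have class_le: "card {u \<in> ?U. c u = y} \<le> R + 1" for y
    using class_size_plus_classes_le(1)[OF finU, of c y] classes cU nR by (simp add: s_def)
  then have class_le_real: "real (card {u \<in> ?U. c u = y}) \<le> real (R + 1)" for y
    by (rule of_nat_mono)
  have Sne: "S \<noteq> {}" using S(2) by auto
  show False
  proof (cases "3 \<le> s")
    case True
    \<comment> \<open>Here \<open>a = 2 * s + R - 3\<close>, and \<open>C\<close> is obtained by
      solving \<open>2 * a + 2 = C + s - 2\<close>.\<close>
    have "l \<le> 2 * real a + 2"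
    proof (rule signless_eigenvalue_le_of_classes[OF assms(2) S(1) Sne c, where A = "R + 1"
        and C = "3 * real s + 2 * real R - 2" and T = "s + k"])
      have "real a = 2 * real s + real R - 3" "real n = 2 * real s + real k + real R"
        using nR na True by linarith+
      then have eqs: "real (card (pverts G)) - real (card S) - real (s + k) = real R"
        "3 * real s + 2 * real R - 2 - 2 * real (R + 1) = 3 * real s - 4"
        "2 * real a + 2 - real (card (pverts G)) - real (card S) + 2 = real s + real R - real k - 2"
        "real (card S) = real s" "real (s + k) = real s + real k"
        "3 * real s + 2 * real R - 2 - 2 = 3 * real s + 2 * real R - 4"
        by (simp_all add: assms(3) s_def[symmetric])
      show "real (card S) * (real (s + k) + (3 * real s + 2 * real R - 2)
          * (real (card (pverts G)) - real (card S) - real (s + k)) / (3 * real s + 2 * real R - 2 - 2 * real (R + 1)))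
        \<le> (3 * real s + 2 * real R - 2 - 2) * (2 * real a + 2 - real (card (pverts G)) - real (card S) + 2)"
        unfolding eqs(1-3) unfolding eqs(4-6) using True nR na by (intro cut_bound_arith) auto
    qed (use class_le_real classes True nR na eig in \<open>auto simp: s_def[symmetric]\<close>)
    with lbig show False by simp
  next
    case False
    then have s2: "s = 2" "card S = 2" using S(2) by (auto simp: s_def)
    then have Ra: "R + 1 = a" using nR na by simp
    show False
    proof (cases "\<exists>y. R < card {u \<in> ?U. c u = y}")
      case False
      \<comment> \<open>With \<open>s = 2\<close> and classes of size at most
        \<open>R = a - 1\<close>, the denominator \<open>C - 2 * A\<close> is 4.\<close>
      have "l \<le> 2 * real a + 2"
      proof (rule signless_eigenvalue_le_of_classes[OF assms(2) S(1) Sne c, where A = R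
          and C = "2 * real a + 2" and T = "k + 2"])
        \<comment> \<open>This is the difference of the two sides of the next inequality, arranged
          so that \<open>4 * k + 5 \<le> a\<close> shows its sign.\<close>
        have "0 \<le> (real a - 4 * k - 5) * a + (2 * k + 3) * (real a - 1)"
          using na by (intro add_nonneg_nonneg mult_nonneg_nonneg) auto
        then have "2 * (real (k + 2) + (2 * real a + 2) * (real a - 1) / 4) \<le> 2 * real a * (real a - k - 1)"
          by (simp add: field_simps)
        moreover have eqs: "real (card (pverts G)) - real (card S) - real (k + 2) = real a - 1"
          "2 * real a + 2 - 2 * real R = 4"
          "2 * real a + 2 - real (card (pverts G)) - real (card S) + 2 = real a - real k - 1"
          "2 * real a + 2 - 2 = 2 * real a"
          using assms(3) s2 na Ra by simp_all
        ultimately show "real (card S) * (real (k + 2) + (2 * real a + 2)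
            * (real (card (pverts G)) - real (card S) - real (k + 2)) / (2 * real a + 2 - 2 * real R))
          \<le> (2 * real a + 2 - 2) * (2 * real a + 2 - real (card (pverts G)) - real (card S) + 2)"
          unfolding eqs(1-3) unfolding eqs(4) s2(2) by simp
      qed (use False classes s2 Ra na eig in \<open>auto simp: not_less\<close>)
      with lbig show False by simp
    next
      case True
      then obtain y where y: "R < card {u \<in> ?U. c u = y}" by blast
      define B where "B = {u \<in> ?U. c u = y}"
      have cB: "card B = a" using y class_le[of y] Ra by (simp add: B_def)
      have B: "B \<subseteq> pverts G" "S \<inter> B = {}" "B \<subseteq> ?U" by (auto simp: B_def)
      \<comment> \<open>The \<open>k + 1\<close> vertices outside \<open>S\<close> and
        \<open>B\<close> carry at least \<open>k + 1\<close> labels, so their labels are distinct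
        and no two of them are adjacent.\<close>
      have "card (?U - B) = k + 1" 
        using cB cU B(3) finU s2 na by (simp add: card_Diff_subset finite_subset)
      moreover have "k + 1 \<le> card (c ` (?U - B))"
        using class_size_plus_classes_le(2)[OF finU, of c y] classes s2 by (simp add: B_def)
      ultimately have "card (c ` (?U - B)) = card (?U - B)"
        using card_image_le[of "?U - B" c] finU by simp
      then have inj: "inj_on c (?U - B)" using finU by (intro eq_card_imp_inj_on) auto
      have "parcs G \<subseteq> joined_arcs (pverts G) S B"
      proof
        fix a assume "a \<in> parcs G"
        then obtain u v where uv: "a = (u, v)" "(u, v) \<in> parcs G" by (cases a) auto
        then have V: "u \<in> pverts G" "v \<in> pverts G" "u \<noteq> v"
          by (auto dest: in_arcsD1 in_arcsD2 no_loops')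
        moreover have "u \<in> B \<and> v \<in> B" if "u \<notin> S" "v \<notin> S"
        proof -
          have cuv: "c u = c v" using c[OF uv(2)] that by simp
          then have "u \<in> B \<longleftrightarrow> v \<in> B" using V that by (auto simp: B_def)
          moreover have "\<not> (u \<in> ?U - B \<and> v \<in> ?U - B)" using inj cuv V(3) by (auto dest: inj_onD)
          ultimately show ?thesis using V that by auto
        qed
        ultimately show "a \<in> joined_arcs (pverts G) S B" by (auto simp: uv(1) joined_arcs_def)
      qed
      note le = signless_eigenvalue_joined_le[OF assms(2) this S(1) B(1,2) s2(2) _ _ _ eig, of \<mu>]
      have "l \<le> \<mu>" by (rule le(1)) (use \<mu> cB assms(3) in auto)
      \<comment> \<open>Both radii coincide, so the equality case forces all arcs of the extremal
        graph.\<close>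
      with l have "l = \<mu>" by simp
      have "parcs G = joined_arcs (pverts G) S B"
        by (rule le(2)[OF _ _ _ \<open>l = \<mu>\<close>]) (use \<mu> cB assms(3) in auto)
      then have "graph_iso G H"
        by (rule joined_graph_iso[OF assms(2) _ H(2) S(1) B(1,2) H(3-5)])
           (use s2 H(6,7,9) cB cH assms(3) in auto)
      with assms(7) show False by simp
    qed
  qed
qed

end
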